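(* Let $A\in\mathbb{F}^{n\times n}$ be nonsingular with at most $m$ nonzero entries per row, let $B\in\mathbb{F}^{n\times s}$ with $\|B\|=1$, and let $X_0=O$, $R_0=B$. Let $X_k\in\mathbb{F}^{n\times s}$ and $R_k\in\mathbb{F}^{n\times s}$ ($k\ge1$) be the $k$th approximation and residual, respectively, generated in finite precision arithmetic by the recursions $$X_{j+1}=X_j+Q_j\alpha_j^\square,\qquad R_{j+1}=R_j-(AQ_j)\alpha_j^\square,\qquad j=0,1,2,\dots,$$ with $Q_j\in\mathbb{F}^{n\times s}$ and $\alpha_j^\square\in\mathbb{F}^{s\times s}$. If the columns of $Q_j$ are (exactly) orthonormal for all $j<k$, then the norm of the residual gap $G_{R_k}:=(B-AX_k)-R_k$ is bounded, up to terms of order $O(\mathbf{u}^2)$, by $$\|G_{R_k}\|\le k\,(3+4s\sqrt{s}+2m\sqrt{s})\,\mathbf{u}\,\|A\|\max_{0<j\le k}\|X_j\|+3(k+1)\,\mathbf{u}\max_{0\le j\le k}\|R_j\|.$$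
   Context: $\mathbb{F}\subset\mathbb{R}$ is the set of floating point numbers, $\mathrm{fl}(\cdot)$ denotes the result of a floating point computation, $\mathbf{u}$ is the unit roundoff, $\|\cdot\|$ is the Frobenius norm, and $m$ is the maximum number of nonzero entries per row of $A$. Here $s\ll n$. Rounding model, for $P,Q\in\mathbb{F}^{n\times s}$ and $\alpha^\square\in\mathbb{F}^{s\times s}$: $\mathrm{fl}(P+Q)=P+Q+E'$ with $\|E'\|\le\mathbf{u}(\|P\|+\|Q\|)$; $\mathrm{fl}(P\alpha^\square)=P\alpha^\square+E^\square$ with $\|E^\square\|\le s\mathbf{u}\|P\|\|\alpha^\square\|$; $\mathrm{fl}(AP)=AP+E'''$ with $\|E'''\|\le m\mathbf{u}\|A\|\|P\|$. Subtraction is treated like addition. Convention: terms of $O(\mathbf{u}^2)$ are omitted, and $\mathbf{u}\|\mathrm{fl}(\ast)\|$ is regarded as $\mathbf{u}\|\ast\|$. "Generated in finite precision arithmetic" means that the computed iterates satisfy $X_{j+1}=\mathrm{fl}(X_j+\mathrm{fl}(Q_j\alpha_j^\square))$ and $R_{j+1}=\mathrm{fl}(R_j-\mathrm{fl}(\mathrm{fl}(AQ_j)\alpha_j^\square))$. The matrix $Q_j$ is obtained by orthonormalizing the columns of a direction matrix $P_j$ of the solver (the range of $Q_j$ equals that of $P_j$), and $\alpha_j^\square$ is whatever (computed) value is supplied by the specific solver. In the definition of $G_{R_k}$ the expression $(B-AX_k)-R_k$ is evaluated exactly. *)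

theory Defs
  imports "HOL-Analysis.Analysis"
begin

text \<open>
  An \<open>n \<times> s\<close> real matrix is an element of \<open>real^'s^'n\<close>, with \<open>n = CARD('n)\<close> and
  \<open>s = CARD('s)\<close>. The library norm on this type is the Frobenius norm:
\<close>

lemma norm_eq_frobenius:
  fixes M :: "real^'s^'n"
  shows "norm M = sqrt (\<Sum>i\<in>UNIV. \<Sum>j\<in>UNIV. (M $ i $ j)\<^sup>2)"
  by (simp add: norm_vec_def L2_set_def sum_nonneg)

definition mats_over :: "real set \<Rightarrow> (real^'c^'r) set"
  where "mats_over F = {M. \<forall>i j. M $ i $ j \<in> F}"

definition row_sparse :: "nat \<Rightarrow> real^'c^'r \<Rightarrow> bool"
  where "row_sparse m M \<longleftrightarrow> (\<forall>i. card {j. M $ i $ j \<noteq> 0} \<le> m)"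

definition orthonormal_columns :: "real^'s^'n \<Rightarrow> bool"
  where "orthonormal_columns Q \<longleftrightarrow>
    (\<forall>i. norm (column i Q) = 1) \<and>
    (\<forall>i j. i \<noteq> j \<longrightarrow> orthogonal (column i Q) (column j Q))"

text \<open>
  The rounding model. \<open>F\<close> is the set of floating point numbers and \<open>u\<close> the unit roundoff;
  \<open>fl_add P Q\<close>, \<open>fl_sub P Q\<close>, \<open>fl_mult P a\<close> and \<open>fl_lmult A P\<close> are the computed values
  \<open>fl(P + Q)\<close>, \<open>fl(P - Q)\<close>, \<open>fl(P a)\<close> (with \<open>a\<close> of size \<open>s \<times> s\<close>) and \<open>fl(A P)\<close>.
  As usual for such models, overflow and underflow are disregarded.
\<close>

locale fp_arithmetic =
  fixes F :: "real set"
    and u :: real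
    and fl_add fl_sub :: "real^'s^'n \<Rightarrow> real^'s^'n \<Rightarrow> real^'s^'n"
    and fl_mult :: "real^'s^'n \<Rightarrow> real^'s^'s \<Rightarrow> real^'s^'n"
    and fl_lmult :: "real^'n^'n \<Rightarrow> real^'s^'n \<Rightarrow> real^'s^'n"
  assumes u_pos: "0 < u"
    and zero_in: "0 \<in> F"
    and fl_add_in: "\<lbrakk>P \<in> mats_over F; Q \<in> mats_over F\<rbrakk> \<Longrightarrow> fl_add P Q \<in> mats_over F"
    and fl_sub_in: "\<lbrakk>P \<in> mats_over F; Q \<in> mats_over F\<rbrakk> \<Longrightarrow> fl_sub P Q \<in> mats_over F"
    and fl_mult_in: "\<lbrakk>P \<in> mats_over F; a \<in> mats_over F\<rbrakk> \<Longrightarrow> fl_mult P a \<in> mats_over F"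
    and fl_lmult_in: "\<lbrakk>A \<in> mats_over F; P \<in> mats_over F\<rbrakk> \<Longrightarrow> fl_lmult A P \<in> mats_over F"
    and fl_add_error:
      "\<lbrakk>P \<in> mats_over F; Q \<in> mats_over F\<rbrakk>
        \<Longrightarrow> norm (fl_add P Q - (P + Q)) \<le> u * (norm P + norm Q)"
    and fl_sub_error:
      "\<lbrakk>P \<in> mats_over F; Q \<in> mats_over F\<rbrakk>
        \<Longrightarrow> norm (fl_sub P Q - (P - Q)) \<le> u * (norm P + norm Q)"
    and fl_mult_error:
      "\<lbrakk>P \<in> mats_over F; a \<in> mats_over F\<rbrakk>
        \<Longrightarrow> norm (fl_mult P a - P ** a) \<le> real CARD('s) * u * norm P * norm a"
    and fl_lmult_error:
      "\<lbrakk>A \<in> mats_over F; row_sparse m A; P \<in> mats_over F\<rbrakk>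
        \<Longrightarrow> norm (fl_lmult A P - A ** P) \<le> real m * u * norm A * norm P"

definition residual_gap :: "real^'n^'n \<Rightarrow> real^'s^'n \<Rightarrow> real^'s^'n \<Rightarrow> real^'s^'n \<Rightarrow> real^'s^'n"
  where "residual_gap A B X R = (B - A ** X) - R"

end

theory Submission imports Defs begin

text \<open>
  Since \<open>Q\<^sub>j\<close> has orthonormal columns, \<open>\<parallel>\<alpha>\<^sub>j\<parallel> = \<parallel>Q\<^sub>j \<alpha>\<^sub>j\<parallel>\<close>, which up to rounding errors is
  \<open>\<parallel>X\<^sub>j\<^sub>+\<^sub>1 - X\<^sub>j\<parallel>\<close> and hence at most \<open>2 max \<parallel>X\<^sub>i\<parallel>\<close>. So the rounding errors committed in one step are
  bounded by the norms of the iterates, and the residual gap is the sum of these errors.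

  The second-order terms need no \<open>C u\<^sup>2\<close>. They carry factors \<open>\<parallel>A\<parallel> max \<parallel>X\<^sub>i\<parallel>\<close> and \<open>max \<parallel>R\<^sub>i\<parallel>\<close> that no
  constant bounds, but for small \<open>u\<close> the first-order bound absorbs them: because \<open>X\<^sub>0 = 0\<close>, the
  first step costs only about half of what is charged for it, and the residual term charges
  \<open>k + 1\<close> steps instead of \<open>k\<close>.
\<close>

section \<open>Frobenius norm estimates, by rows and by columns\<close>

lemma norm_transpose_matrix:
  fixes M :: "real^'s^'n"
  shows "norm (transpose M) = norm M"
  unfolding norm_eq_frobenius by (subst sum.swap) (simp add: transpose_def)

text \<open>Holds because the Frobenius norm is the Euclidean norm of the vector of row norms.
  Applied to transposes, it lifts columnwise estimates as well.\<close>

lemma norm_matrix_row_mono: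
  fixes M :: "real^'s^'n" and N :: "real^'t^'n"
  assumes "\<And>i. norm (M $ i) \<le> c * norm (N $ i)" "0 \<le> c"
  shows "norm M \<le> c * norm N"
  unfolding norm_vec_def[of M] norm_vec_def[of N]
  using assms by (simp add: L2_set_right_distrib L2_set_mono)

lemma transpose_mult_row:
  fixes A :: "real^'m^'n" and B :: "real^'p^'m"
  shows "transpose (A ** B) $ j = A *v (transpose B $ j)"
  by (simp add: vec_eq_iff transpose_def matrix_matrix_mult_def matrix_vector_mult_def)

lemma mult_row:
  fixes A :: "real^'m^'n" and B :: "real^'p^'m"
  shows "(A ** B) $ i = A $ i v* B"
  by (simp add: vec_eq_iff matrix_matrix_mult_def vector_matrix_mult_def mult.commute)

lemma matrix_mult_add_left:
  fixes A B :: "'a::semiring_1^'m^'n" and C :: "'a^'p^'m"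
  shows "(A + B) ** C = A ** C + B ** C"
  by (simp add: vec_eq_iff matrix_matrix_mult_def distrib_right sum.distrib)

lemma norm_matrix_vector_mult_le:
  fixes A :: "real^'m^'n"
  shows "norm (A *v x) \<le> norm A * norm x"
proof -
  have "L2_set (\<lambda>i. norm ((A *v x) $ i)) UNIV \<le> L2_set (\<lambda>i. norm (A $ i) * norm x) UNIV"
    by (rule L2_set_mono) (simp_all add: matrix_mult_dot Cauchy_Schwarz_ineq2)
  then show ?thesis
    by (simp add: norm_vec_def[of A] norm_vec_def[of "A *v x"] L2_set_left_distrib)
qed

text \<open>The columns of the product are the images under \<open>A\<close> of the columns of
  \<open>B\<close>, so the matrix-vector estimate lifts column by column.\<close>

lemma norm_matrix_mult_le:
  fixes A :: "real^'m^'n" and B :: "real^'p^'m"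
  shows "norm (A ** B) \<le> norm A * norm B"
proof -
  have "norm (transpose (A ** B)) \<le> norm A * norm (transpose B)"
    by (rule norm_matrix_row_mono) (simp_all add: transpose_mult_row norm_matrix_vector_mult_le)
  then show ?thesis by (simp add: norm_transpose_matrix)
qed

section \<open>Multiplication by matrices with orthonormal columns\<close>

lemma orthonormal_columns_transpose_mult:
  fixes Q :: "real^'s^'n"
  assumes "orthonormal_columns Q"
  shows "transpose Q ** Q = mat 1"
  using assms
  by (auto simp: orthonormal_columns_def orthogonal_def norm_eq_1 matrix_mult_transpose_dot_column
      mat_def vec_eq_iff)

lemma orthonormal_columns_norm:
  fixes Q :: "real^'s^'n"
  assumes "orthonormal_columns Q"
  shows "norm Q = sqrt (real CARD('s))"
proof -
  have "norm (transpose Q $ j) = 1" for j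
    using assms by (simp add: orthonormal_columns_def column_def transpose_def)
  then have "norm (transpose Q) = sqrt (real CARD('s))"
    unfolding norm_vec_def[of "transpose Q"] by (simp add: L2_set_def)
  then show ?thesis by (simp add: norm_transpose_matrix)
qed

lemma orthonormal_columns_norm_vec:
  fixes Q :: "real^'s^'n"
  assumes "orthonormal_columns Q"
  shows "norm (Q *v x) = norm x"
proof -
  have "(Q *v x) \<bullet> (Q *v x) = x \<bullet> (transpose Q *v (Q *v x))"
    by (metis dot_lmul_matrix inner_commute transpose_matrix_vector)
  then show ?thesis
    by (simp add: norm_eq matrix_vector_mul_assoc orthonormal_columns_transpose_mult[OF assms])
qed

text \<open>The transpose of an isometry is a contraction: pair \<open>x v* Q\<close> with itself,
  move \<open>Q\<close> to the other side, and apply Cauchy-Schwarz.\<close>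

lemma orthonormal_columns_norm_vector_matrix_le:
  fixes Q :: "real^'s^'n"
  assumes "orthonormal_columns Q"
  shows "norm (x v* Q) \<le> norm x"
proof -
  let ?y = "x v* Q"
  have "norm ?y * norm ?y = x \<bullet> (Q *v ?y)"
    by (metis dot_lmul_matrix dot_square_norm power2_eq_square)
  also have "\<dots> \<le> norm x * norm ?y"
    using norm_cauchy_schwarz[of x "Q *v ?y"] by (simp add: orthonormal_columns_norm_vec[OF assms])
  finally show ?thesis by (cases "?y = 0") auto
qed

lemma orthonormal_columns_norm_left_mult:
  fixes Q :: "real^'s^'n" and a :: "real^'t^'s"
  assumes "orthonormal_columns Q"
  shows "norm (Q ** a) = norm a"
proof -
  have "norm (transpose (Q ** a)) = norm (transpose a)"
    by (simp add: norm_vec_def[of "transpose (Q ** a)"] norm_vec_def[of "transpose a"]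
        transpose_mult_row orthonormal_columns_norm_vec[OF assms])
  then show ?thesis by (simp add: norm_transpose_matrix)
qed

text \<open>Rows of \<open>A\<close> are only contracted by \<open>Q\<close>. This avoids the factor
  \<open>norm Q\<close>, the square root of s, that submultiplicativity would cost.\<close>

lemma orthonormal_columns_norm_right_mult_le:
  fixes Q :: "real^'s^'n" and A :: "real^'n^'m"
  assumes "orthonormal_columns Q"
  shows "norm (A ** Q) \<le> norm A"
proof -
  have "norm ((A ** Q) $ i) \<le> 1 * norm (A $ i)" for i
    by (simp add: mult_row orthonormal_columns_norm_vector_matrix_le[OF assms])
  from norm_matrix_row_mono[OF this] show ?thesis by simp
qed

section \<open>Rounding errors of one step of the recursion\<close>

context fp_arithmetic
begin

text \<open>The exact updates cancel in the gap, leaving five rounding errors. In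
  \<open>1 + 2*t + w\<close>, the 1 comes from the computed update in the addition,
  \<open>2*t\<close> from the two products with \<open>a\<close>, and \<open>w\<close> from the
  product of \<open>A\<close> and \<open>Q\<close>. The ratio \<open>y\<close> is 0 in the first
  step and 1 later; \<open>K\<close> absorbs second-order factors.\<close>

lemma residual_gap_step:
  fixes A :: "real^'n^'n" and B X R Q X' R' :: "real^'s^'n" and a :: "real^'s^'s"
  fixes m :: nat and K M y \<rho> :: real
  defines "t \<equiv> real CARD('s) * sqrt (real CARD('s))"
  defines "w \<equiv> real m * sqrt (real CARD('s))"
  assumes mem: "A \<in> mats_over F" "X \<in> mats_over F" "R \<in> mats_over F" "Q \<in> mats_over F" "a \<in> mats_over F"
  assumes sparse: "row_sparse m A" and orth: "orthonormal_columns Q"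
  assumes X': "X' = fl_add X (fl_mult Q a)"
    and R': "R' = fl_sub R (fl_mult (fl_lmult A Q) a)"
  assumes u: "u \<le> 1/2" "t * u \<le> 1/2" and K: "(1 + 4*u) * (1 + 2*t*u) * (1 + w*u) \<le> K"
  assumes bd: "norm X \<le> y * M" "norm X' \<le> M" "norm R \<le> \<rho>" "norm R' \<le> \<rho>" and y: "0 \<le> y"
  shows "norm (residual_gap A B X' R') \<le> norm (residual_gap A B X R)
    + u * norm A * ((y + (1 + y) * K * (1 + 2*t + w)) * M) + 3 * u * \<rho> / (1 - u)"
proof -
  define d where "d = fl_mult Q a"
  define Z where "Z = fl_lmult A Q"
  define g where "g = fl_mult Z a"
  define E1 where "E1 = d - Q ** a"
  define E2 where "E2 = X' - (X + d)"
  define E3 where "E3 = Z - A ** Q"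
  define E4 where "E4 = g - Z ** a"
  define E5 where "E5 = R' - (R - g)"
  define s where "s = real CARD('s)"
  have s1: "1 \<le> s" by (simp add: s_def Suc_leI)
  have st: "s \<le> t" using s1 by (simp add: t_def s_def[symmetric])
  have t0: "0 \<le> t" and w0: "0 \<le> w" by (simp_all add: t_def w_def)
  have dF: "d \<in> mats_over F" and ZF: "Z \<in> mats_over F" and gF: "g \<in> mats_over F"
    by (simp_all add: d_def Z_def g_def fl_mult_in fl_lmult_in mem)
  have M0: "0 \<le> M" using bd(2) norm_ge_zero order_trans by blast
  have nQ: "norm Q = sqrt s" using orthonormal_columns_norm[OF orth] by (simp add: s_def)
  have e1: "norm E1 \<le> t * u * norm a"
    using fl_mult_error[OF mem(4,5)] by (simp add: E1_def d_def nQ t_def s_def mult_ac)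
  have e2: "norm E2 \<le> u * (norm X + norm d)"
    using fl_add_error[OF mem(2) dF] by (simp add: E2_def X' d_def)
  have e3: "norm E3 \<le> w * u * norm A"
    using fl_lmult_error[OF mem(1) sparse mem(4)] by (simp add: E3_def Z_def nQ w_def s_def mult_ac)
  have "norm Z \<le> norm (A ** Q) + norm E3"
    using norm_triangle_ineq[of "A ** Q" E3] by (simp add: E3_def)
  then have nZ: "norm Z \<le> (1 + w*u) * norm A"
    using e3 orthonormal_columns_norm_right_mult_le[OF orth, of A] by (simp add: algebra_simps)
  have "norm E4 \<le> s * u * norm Z * norm a"
    using fl_mult_error[OF ZF mem(5)] by (simp add: E4_def g_def s_def)
  also have "\<dots> \<le> t * u * ((1 + w*u) * norm A) * norm a"
    using u_pos st s1 t0 w0 nZ by (intro mult_mono) auto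
  finally have e4: "norm E4 \<le> t * u * ((1 + w*u) * norm A) * norm a" .
  have e5: "norm E5 \<le> u * (norm R + norm g)"
    using fl_sub_error[OF mem(3) gF] by (simp add: E5_def R' g_def Z_def)

  \<comment> \<open>The bound on \<open>E2\<close> itself contains \<open>norm d\<close>, so the
    inequality is solved for \<open>norm d\<close>. For \<open>u \<le> 1/2\<close>, dividing
    \<open>1 + u\<close> by \<open>1 - u\<close> gives at most \<open>1 + 4*u\<close>.\<close>
  have "norm d \<le> norm X' + norm X + norm E2"
    using norm_triangle_ineq4[of "X' - X" E2] norm_triangle_ineq4[of X' X] by (simp add: E2_def)
  then have "norm d * (1 - u) \<le> norm X' + (1 + u) * norm X"
    using e2 by (simp add: algebra_simps)
  also have "\<dots> \<le> M + (1 + u) * (y * M)"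
    using bd u_pos by (intro add_mono mult_left_mono) auto
  also have "\<dots> \<le> (1 + y) * M * (1 + u)"
    using u_pos M0 by (simp add: algebra_simps)
  also have "\<dots> \<le> (1 + y) * M * ((1 + 4*u) * (1 - u))"
  proof -
    have "u * u \<le> u * (1/2)" using u(1) u_pos by (intro mult_left_mono) auto
    then show ?thesis using M0 y by (intro mult_left_mono) (auto simp: algebra_simps)
  qed
  finally have nd: "norm d \<le> (1 + y) * M * (1 + 4*u)"
    using u(1) by (simp flip: mult.assoc)
  \<comment> \<open>Orthonormality turns \<open>norm a\<close> into \<open>norm (Q ** a)\<close>.
    The bound on \<open>E1\<close> is again implicit in \<open>norm a\<close>, and
    \<open>t * u \<le> 1/2\<close> allows solving for it.\<close>
  have "norm a \<le> norm d + norm E1"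
    using norm_triangle_ineq4[of d E1] orthonormal_columns_norm_left_mult[OF orth, of a]
    by (simp add: E1_def)
  then have "norm a * (1 - t*u) \<le> norm d" using e1 by (simp add: algebra_simps)
  also have "\<dots> \<le> norm d * ((1 + 2*t*u) * (1 - t*u))"
  proof -
    have "(t*u) * (t*u) \<le> (t*u) * (1/2)" using u(2) u_pos t0 by (intro mult_left_mono) auto
    then have "1 \<le> (1 + 2*t*u) * (1 - t*u)" by (simp add: algebra_simps)
    then show ?thesis by (simp add: mult_left_le mult_le_cancel_left1)
  qed
  finally have "norm a \<le> norm d * (1 + 2*t*u)"
    using u(2) by (simp flip: mult.assoc)
  also have "\<dots> \<le> (1 + y) * M * (1 + 4*u) * (1 + 2*t*u)"
    using nd t0 u_pos by (intro mult_right_mono) auto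
  finally have na: "norm a \<le> (1 + y) * M * (1 + 4*u) * (1 + 2*t*u)" .
  \<comment> \<open>The extra factor \<open>1 + w*u\<close> enters \<open>E4\<close> through
    \<open>norm Z\<close>.\<close>
  have "norm a * (1 + w*u) \<le> (1 + y) * M * (1 + 4*u) * (1 + 2*t*u) * (1 + w*u)"
    using na w0 u_pos by (intro mult_right_mono) auto
  also have "\<dots> = (1 + y) * M * ((1 + 4*u) * (1 + 2*t*u) * (1 + w*u))" by simp
  also have "\<dots> \<le> (1 + y) * M * K" using K y M0 by (intro mult_left_mono) auto
  finally have naw: "norm a * (1 + w*u) \<le> (1 + y) * M * K" .
  have "norm a * 1 \<le> norm a * (1 + w*u)" using w0 u_pos by (intro mult_left_mono) auto
  with naw have naK: "norm a \<le> (1 + y) * M * K" by simp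
  have "(1 + 4*u) * 1 * 1 \<le> (1 + 4*u) * (1 + 2*t*u) * (1 + w*u)"
    using t0 w0 u_pos by (intro mult_mono) auto
  then have "(1 + y) * M * (1 + 4*u) \<le> (1 + y) * M * K"
    using K y M0 by (intro mult_left_mono) auto
  with nd have ndK: "norm d \<le> (1 + y) * M * K" by simp

  \<comment> \<open>Eliminating \<open>g\<close> leaves \<open>norm R\<close> twice and
    \<open>norm R'\<close> once, hence the 3; solving for \<open>norm E5\<close> produces the
    denominator \<open>1 - u\<close>.\<close>
  have "norm g \<le> norm R + norm R' + norm E5"
    using norm_triangle_ineq4[of R R'] norm_triangle_ineq[of "R - R'" E5] by (simp add: E5_def)
  then have "norm E5 \<le> u * (3 * \<rho> + norm E5)"
    using e5 bd u_pos by (smt (verit) mult_left_mono)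
  then have e5': "norm E5 \<le> 3 * u * \<rho> / (1 - u)"
    using u(1) by (simp add: field_simps)

  have "A ** X' = A ** X + A ** (Q ** a) + A ** E1 + A ** E2"
    by (simp add: E1_def E2_def flip: matrix_add_ldistrib)
  \<comment> \<open>This exposes the term \<open>Z ** a\<close> that cancels against the one in the
    residual update.\<close>
  moreover have "A ** (Q ** a) = Z ** a - E3 ** a"
  proof -
    have "Z ** a = (A ** Q + E3) ** a" by (simp add: E3_def)
    then show ?thesis by (simp add: matrix_mult_add_left matrix_mul_assoc)
  qed
  ultimately have "residual_gap A B X' R'
      = residual_gap A B X R - A ** E1 - A ** E2 + E4 + E3 ** a - E5"
    by (simp add: residual_gap_def E4_def E5_def)
  moreover have "norm (g0 - h1 - h2 + h3 + h4 - h5)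
      \<le> norm g0 + norm h1 + norm h2 + norm h3 + norm h4 + norm h5"
    for g0 h1 h2 h3 h4 h5 :: "real^'s^'n"
    by norm
  ultimately have "norm (residual_gap A B X' R') \<le> norm (residual_gap A B X R)
      + norm (A ** E1) + norm (A ** E2) + norm E4 + norm (E3 ** a) + norm E5"
    by simp
  also have "\<dots> \<le> norm (residual_gap A B X R) + norm A * (t * u * norm a)
      + norm A * (u * (y * M + norm d)) + t * u * ((1 + w*u) * norm A) * norm a
      + w * u * norm A * norm a + 3 * u * \<rho> / (1 - u)"
  proof -
    have "norm (A ** E1) \<le> norm A * (t * u * norm a)"
      using norm_matrix_mult_le[of A E1] e1 by (meson mult_left_mono norm_ge_zero order_trans)
    moreover have "u * (norm X + norm d) \<le> u * (y * M + norm d)"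
      using bd u_pos by (intro mult_left_mono) auto
    then have "norm (A ** E2) \<le> norm A * (u * (y * M + norm d))"
      using norm_matrix_mult_le[of A E2] e2 by (meson mult_left_mono norm_ge_zero order_trans)
    moreover have "norm (E3 ** a) \<le> w * u * norm A * norm a"
      using norm_matrix_mult_le[of E3 a] e3 by (meson mult_right_mono norm_ge_zero order_trans)
    ultimately show ?thesis using e4 e5' by linarith
  qed
  also have "\<dots> = norm (residual_gap A B X R)
      + u * norm A * (y * M + norm d + (t + w) * norm a + t * (norm a * (1 + w*u)))
      + 3 * u * \<rho> / (1 - u)"
    by (simp add: algebra_simps)
  also have "\<dots> \<le> norm (residual_gap A B X R)
      + u * norm A * (y * M + (1 + y) * M * K + (t + w) * ((1 + y) * M * K) + t * ((1 + y) * M * K))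
      + 3 * u * \<rho> / (1 - u)"
    using ndK naK naw t0 w0 u_pos
    by (intro add_mono mult_left_mono order_refl) auto
  also have "\<dots> = norm (residual_gap A B X R)
      + u * norm A * ((y + (1 + y) * K * (1 + 2*t + w)) * M) + 3 * u * \<rho> / (1 - u)"
    by (simp add: algebra_simps)
  finally show ?thesis .
qed

section \<open>Accumulation of the errors over all steps\<close>

lemma iterates_in:
  assumes A: "A \<in> mats_over F" and B: "B \<in> mats_over F"
    and X0: "X 0 = 0" and R0: "R 0 = B"
    and Qa: "\<forall>j<k. Q j \<in> mats_over F \<and> \<alpha> j \<in> mats_over F"
    and X: "\<forall>j<k. X (Suc j) = fl_add (X j) (fl_mult (Q j) (\<alpha> j))"
    and R: "\<forall>j<k. R (Suc j) = fl_sub (R j) (fl_mult (fl_lmult A (Q j)) (\<alpha> j))"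
  shows "j \<le> k \<Longrightarrow> X j \<in> mats_over F \<and> R j \<in> mats_over F"
proof (induction j)
  case 0
  then show ?case using X0 R0 B zero_in by (simp add: mats_over_def)
next
  case (Suc j)
  then show ?case
    using A Qa X R by (simp add: Suc_le_eq fl_add_in fl_sub_in fl_mult_in fl_lmult_in)
qed

text \<open>The hypothesis on \<open>u\<close> makes the sum of the first-order terms in the factors
  majorized by \<open>K\<close> at most 1/(4k).\<close>

lemma residual_gap_bound:
  fixes A :: "real^'n^'n" and B :: "real^'s^'n" and X R Q :: "nat \<Rightarrow> real^'s^'n"
    and \<alpha> :: "nat \<Rightarrow> real^'s^'s" and m k :: nat
  defines "t \<equiv> real CARD('s) * sqrt (real CARD('s))"
  defines "w \<equiv> real m * sqrt (real CARD('s))"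
  defines "M \<equiv> MAX j\<in>{0<..k}. norm (X j)"
  defines "\<rho> \<equiv> MAX j\<in>{0..k}. norm (R j)"
  assumes k: "1 \<le> k" and u: "u \<le> 1 / (4 * real k * (4 + 2*t + w))"
    and A: "A \<in> mats_over F" and B: "B \<in> mats_over F" and sparse: "row_sparse m A"
    and X0: "X 0 = 0" and R0: "R 0 = B"
    and Qa: "\<forall>j<k. Q j \<in> mats_over F \<and> \<alpha> j \<in> mats_over F"
    and X: "\<forall>j<k. X (Suc j) = fl_add (X j) (fl_mult (Q j) (\<alpha> j))"
    and R: "\<forall>j<k. R (Suc j) = fl_sub (R j) (fl_mult (fl_lmult A (Q j)) (\<alpha> j))"
    and orth: "\<forall>j<k. orthonormal_columns (Q j)"
  shows "norm (residual_gap A B (X k) (R k))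
    \<le> real k * (3 + 4*t + 2*w) * u * norm A * M + 3 * (real k + 1) * u * \<rho>"
proof -
  \<comment> \<open>\<open>K\<close> majorizes all second-order factors; with \<open>W\<close> below, the first step saves at
    least \<open>W\<close>, which covers the total excess because \<open>(K - 1) (2 k - 1) \<le> 1\<close>.\<close>
  define K where "K = 1 + 1 / (2 * real k)"
  define W where "W = 1 + 2*t + w"
  define e where "e = 3 * u * \<rho> / (1 - u)"
  have t0: "0 \<le> t" and w0: "0 \<le> w" by (simp_all add: t_def w_def)
  have kr: "1 \<le> real k" using k by simp
  have "u * (4 * real k * (4 + 2*t + w)) \<le> 1"
  proof -
    have "0 < 4 * real k * (4 + 2*t + w)"
      using kr t0 w0 by (intro mult_pos_pos add_pos_nonneg) auto
    with u show ?thesis by (simp only: pos_le_divide_eq)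
  qed
  then have z: "(4 + 2*t + w) * u \<le> 1 / (4 * real k)" using kr by (simp add: field_simps)
  have z1: "1 / (4 * real k) \<le> 1/4" using kr by (simp add: field_simps)
  have z0: "4*u + 2*(t*u) + w*u \<le> 1 / (4 * real k)" using z by (simp add: algebra_simps)
  have pos: "0 \<le> t*u" "0 \<le> w*u" using t0 w0 u_pos by simp_all
  have u2: "u \<le> 1/2" "t * u \<le> 1/2" using z0 z1 pos u_pos by linarith+
  have Kle: "(1 + 4*u) * (1 + 2*t*u) * (1 + w*u) \<le> K"
  proof -
    let ?z = "4*u + 2*t*u + w*u"
    \<comment> \<open>Exponentials merge the three factors into one exponent \<open>?z\<close> in
      [0,1], where \<open>exp ?z\<close> is at most \<open>1 + 2 * ?z\<close>.\<close>
    have "(1 + 4*u) * (1 + 2*t*u) * (1 + w*u) \<le> exp (4*u) * exp (2*t*u) * exp (w*u)"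
      using pos u_pos by (intro mult_mono exp_ge_add_one_self) auto
    also have "\<dots> = exp ?z" by (simp add: exp_add)
    also have "\<dots> \<le> 1 + ?z + ?z\<^sup>2"
      using z0 z1 pos u_pos by (intro exp_bound) auto
    also have "\<dots> \<le> 1 + ?z + ?z * 1"
      unfolding power2_eq_square using z0 z1 pos u_pos
      by (intro add_mono mult_left_mono order_refl) auto
    also have "\<dots> = 1 + 2 * (4*u + 2*(t*u) + w*u)" by simp
    also have "\<dots> \<le> 1 + 2 * (1 / (4 * real k))"
      by (intro add_left_mono mult_left_mono z0) simp
    also have "\<dots> = K" by (simp add: K_def)
    finally show ?thesis .
  qed
  have XM: "norm (X j) \<le> M" if "0 < j" "j \<le> k" for j
    unfolding M_def using that by (intro Max_ge) auto
  have R\<rho>: "norm (R j) \<le> \<rho>" if "j \<le> k" for j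
    unfolding \<rho>_def using that by (intro Max_ge) auto
  have M0: "0 \<le> M" using XM[of k] k norm_ge_zero[of "X k"] by linarith
  have \<rho>0: "0 \<le> \<rho>" using R\<rho>[of k] norm_ge_zero[of "R k"] by linarith
  note mem = iterates_in[OF A B X0 R0 Qa X R]
  have step: "norm (residual_gap A B (X (Suc j)) (R (Suc j))) \<le> norm (residual_gap A B (X j) (R j))
      + u * norm A * ((y + (1 + y) * K * W) * M) + e"
    if "j < k" "norm (X j) \<le> y * M" "0 \<le> y" for j y
    unfolding e_def W_def t_def w_def
  proof (rule residual_gap_step)
    show "u \<le> 1/2" by (rule u2)
    show "real CARD('s) * sqrt (real CARD('s)) * u \<le> 1/2" using u2 by (simp add: t_def)
    show "(1 + 4 * u) * (1 + 2 * (real CARD('s) * sqrt (real CARD('s))) * u) *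
        (1 + real m * sqrt (real CARD('s)) * u) \<le> K" using Kle by (simp add: t_def w_def)
  qed (use that A sparse Qa X R orth mem[of j] XM[of "Suc j"] R\<rho>[of j] R\<rho>[of "Suc j"] in auto)
  have gap: "norm (residual_gap A B (X (Suc j)) (R (Suc j)))
      \<le> u * norm A * ((K * W + real j * (1 + 2 * K * W)) * M) + real (Suc j) * e" if "j < k" for j
    using that
  proof (induction j)
    case 0
    have "residual_gap A B (X 0) (R 0) = 0"
      by (simp add: residual_gap_def X0 R0)
    then show ?case using step[of 0 0] k X0 by simp
  next
    case (Suc j)
    then have "norm (residual_gap A B (X (Suc (Suc j))) (R (Suc (Suc j))))
      \<le> u * norm A * ((K * W + real j * (1 + 2 * K * W)) * M) + real (Suc j) * e
        + u * norm A * ((1 + (1 + 1) * K * W) * M) + e"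
      \<comment> \<open>The ratio is 1 from here on, since \<open>M\<close> is a maximum over
        positive indices only.\<close>
      using step[of "Suc j" 1] XM[of "Suc j"] by simp
    then show ?case by (simp add: algebra_simps)
  qed
  obtain k' where k': "k = Suc k'" using k by (cases k) auto
  have "norm (residual_gap A B (X k) (R k))
      \<le> u * norm A * ((K * W + real k' * (1 + 2 * K * W)) * M) + real k * e"
    using gap[of k'] k' by simp
  also have "\<dots> \<le> u * norm A * ((real k * (1 + 2 * W)) * M) + 3 * (real k + 1) * u * \<rho>"
  proof (rule add_mono)
    have "K * (2 * real k - 1) \<le> 2 * real k"
      using kr by (simp add: K_def field_simps)
    moreover have "0 \<le> W" using t0 w0 by (simp add: W_def)
    ultimately have "W * (K * (2 * real k - 1)) \<le> W * (2 * real k)"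
      by (rule mult_left_mono)
    then have "K * W + real k' * (1 + 2 * K * W) \<le> real k * (1 + 2 * W)"
      by (simp add: k' algebra_simps)
    then show "u * norm A * ((K * W + real k' * (1 + 2 * K * W)) * M)
        \<le> u * norm A * ((real k * (1 + 2 * W)) * M)"
      using u_pos M0 by (intro mult_left_mono mult_right_mono) auto
    \<comment> \<open>Equivalent to \<open>real k / (1 - u) \<le> real k + 1\<close>: the one spare
      residual term pays for all \<open>k\<close> denominators.\<close>
    have "u * (real k + 1) \<le> 1"
    proof -
      have "4 * u \<le> 1 / (4 * real k)" using z0 pos by linarith
      then have "u * real k \<le> 1/16" using kr by (simp add: field_simps)
      then show ?thesis using u2 by (simp add: algebra_simps)
    qed
    then have "real k / (1 - u) \<le> real k + 1" using u2 by (simp add: field_simps)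
    then have "3 * u * \<rho> * (real k / (1 - u)) \<le> 3 * u * \<rho> * (real k + 1)"
      using u_pos \<rho>0 by (intro mult_left_mono) auto
    then show "real k * e \<le> 3 * (real k + 1) * u * \<rho>" by (simp add: e_def mult_ac)
  qed
  finally show ?thesis by (simp add: W_def algebra_simps)
qed

end

theorem theorem2p2:
  fixes m k :: nat
  assumes "1 \<le> k"
  shows "\<exists>C u0. 0 < u0 \<and>
    (\<forall>(F :: real set) (u :: real)
      (fl_add :: real^'s^'n \<Rightarrow> real^'s^'n \<Rightarrow> real^'s^'n) fl_sub fl_mult fl_lmult
      (A :: real^'n^'n) (B :: real^'s^'n)
      (X :: nat \<Rightarrow> real^'s^'n) (R :: nat \<Rightarrow> real^'s^'n)
      (Q :: nat \<Rightarrow> real^'s^'n) (\<alpha> :: nat \<Rightarrow> real^'s^'s).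
      fp_arithmetic F u fl_add fl_sub fl_mult fl_lmult \<longrightarrow> u \<le> u0 \<longrightarrow>
      A \<in> mats_over F \<longrightarrow> invertible A \<longrightarrow> row_sparse m A \<longrightarrow>
      B \<in> mats_over F \<longrightarrow> norm B = 1 \<longrightarrow>
      X 0 = 0 \<longrightarrow> R 0 = B \<longrightarrow>
      (\<forall>j<k. Q j \<in> mats_over F \<and> \<alpha> j \<in> mats_over F) \<longrightarrow>
      (\<forall>j<k. X (Suc j) = fl_add (X j) (fl_mult (Q j) (\<alpha> j))) \<longrightarrow>
      (\<forall>j<k. R (Suc j) = fl_sub (R j) (fl_mult (fl_lmult A (Q j)) (\<alpha> j))) \<longrightarrow>
      (\<forall>j<k. orthonormal_columns (Q j)) \<longrightarrow>
      norm (residual_gap A B (X k) (R k))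
        \<le> real k * (3 + 4 * real CARD('s) * sqrt (real CARD('s)) + 2 * real m * sqrt (real CARD('s)))
            * u * norm A * (MAX j\<in>{0<..k}. norm (X j))
          + 3 * (real k + 1) * u * (MAX j\<in>{0..k}. norm (R j))
          + C * u\<^sup>2)"
\<comment> \<open>The witnesses are \<open>C = 0\<close> and the threshold of
  \<open>residual_gap_bound\<close>, which depends only on \<open>k\<close>, \<open>m\<close> and s
  and so is uniform in the arithmetic and the data.\<close>
proof (rule exI[of _ 0],
    rule exI[of _ "1 / (4 * real k * (4 + 2 * (real CARD('s) * sqrt (real CARD('s)))
      + real m * sqrt (real CARD('s))))"],
    intro conjI allI impI, goal_cases)
  case 1
  show ?case
    using assms by (intro divide_pos_pos mult_pos_pos add_pos_nonneg) auto
next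
  case (2 F u fl_add fl_sub fl_mult fl_lmult A B X R Q \<alpha>)
  then interpret fp_arithmetic F u fl_add fl_sub fl_mult fl_lmult by blast
  have "norm (residual_gap A B (X k) (R k))
      \<le> real k * (3 + 4 * (real CARD('s) * sqrt (real CARD('s))) + 2 * (real m * sqrt (real CARD('s))))
          * u * norm A * (MAX j\<in>{0<..k}. norm (X j))
        + 3 * (real k + 1) * u * (MAX j\<in>{0..k}. norm (R j))"
    using 2 assms by (intro residual_gap_bound) auto
  also have "\<dots> = \<dots> + 0 * u\<^sup>2" by simp
  finally show ?case by (simp only: mult.assoc)
qed

end
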